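(* Let $b$ be a fixed integer. Then the elements of $I_{b,c}^{3,tr}$ are distributed almost uniformly in the unit interval for sufficiently large negative $c$ (i.e. for integers $c$ with $c<0$ and $|c|$ sufficiently large).
   Context: For integers $m, n$ satisfying $n \le -m-3$, define $$I_{m,n}^{3,tr} := \{\alpha \in (0,1) \mid \alpha^3+m\alpha^2+n\alpha+d=0 \text{ for some } d \in \mathbb{Z},\ 1 \le d \le -m-n-2\}.$$ Almost uniformity: let $S_1, S_2, \dots$ be a family of finite sets in $[0,1]$, where $S_N$ has $N$ elements $x_1 < x_2 < \dots < x_N$, and put $\Delta_i := x_{i+1}-x_i$ for $i \in \{1,\dots,N-1\}$. Suppose there is a constant $C$ independent of $N$ such that $\max_{1 \le i \le N-1} \left|\Delta_i - \frac{1}{N}\right| \le \frac{C}{N^2}$ for all $N$. Then the elements of $S_N$ are said to be distributed almost uniformly in the unit interval if $N \ge 2C$; without specifying $C$, one says that the elements of $S_N$ are distributed almost uniformly in the unit interval for sufficiently large $N$. Thus the assertion "almost uniformly for sufficiently large $N$" means that such a constant $C$ exists. Here, for fixed $b$, the family is indexed by the number of elements $N = -b-c-2$ of $I_{b,c}^{3,tr}$, i.e. $S_N = I_{b,\,-b-2-N}^{3,tr}$ for $N = 1,2,\dots$; the constant $C$ may depend on $b$. *)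

theory Defs
  imports Complex_Main
begin

definition I3tr :: "int \<Rightarrow> int \<Rightarrow> real set" where
  "I3tr m n = {\<alpha> \<in> {0<..<1}. \<exists>d::int. 1 \<le> d \<and> d \<le> - m - n - 2 \<and>
     \<alpha> ^ 3 + of_int m * \<alpha> ^ 2 + of_int n * \<alpha> + of_int d = 0}"

(* With A = {x_1 < ... < x_N}, gap A i is x_(i+1) - x_i for 1 \<le> i \<le> N - 1;
   the list index starts at 0, so x_i is entry i - 1. *)
definition gap :: "real set \<Rightarrow> nat \<Rightarrow> real" where
  "gap A i = sorted_list_of_set A ! i - sorted_list_of_set A ! (i - 1)"

definition unit_interval_family :: "(nat \<Rightarrow> real set) \<Rightarrow> bool" where
  "unit_interval_family S \<longleftrightarrow>
     (\<forall>N\<ge>1. finite (S N) \<and> S N \<subseteq> {0..1} \<and> card (S N) = N)"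

(* The bound on the maximum over i is written as a bound for every i;
   for N = 1 there are no gaps and no condition. *)
definition spacing_constant :: "(nat \<Rightarrow> real set) \<Rightarrow> real \<Rightarrow> bool" where
  "spacing_constant S C \<longleftrightarrow>
     (\<forall>N\<ge>1. \<forall>i\<in>{1..N - 1}. \<bar>gap (S N) i - 1 / real N\<bar> \<le> C / real N ^ 2)"

(* With the constant C given, the elements of S N are called almost uniformly
   distributed when N \<ge> 2 * C. "For sufficiently large N" leaves C unspecified,
   so it asserts that one C serves the whole family. *)
definition almost_uniform_for_large :: "(nat \<Rightarrow> real set) \<Rightarrow> bool" where
  "almost_uniform_for_large S \<longleftrightarrow>
     unit_interval_family S \<and> (\<exists>C. spacing_constant S C)"

end

theory Submission
  imports Defs
begin

text \<open>
  Put \<open>f x = x\<^sup>3 + b x\<^sup>2 + c x\<close>, so that \<open>f 0 = 0\<close> and \<open>f 1 = - (N + 1)\<close>. By the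
  intermediate value theorem \<open>f\<close> takes each value \<open>- d\<close> with \<open>1 \<le> d \<le> N\<close> in the unit
  interval. It does so only once: given two roots \<open>x, y\<close> of \<open>f + d\<close> in the interval, the
  third root \<open>z\<close> satisfies \<open>x y z = - d < 0\<close>, hence \<open>z < 0\<close>, and then
  \<open>f 1 + d = (1 - x) (1 - y) (1 - z) > 0\<close>, a contradiction. The roots increase with \<open>d\<close>,
  because \<open>f + d\<close> is negative at every root of \<open>f + e\<close> with \<open>e > d\<close>.
  For consecutive roots \<open>x < y\<close>, dividing \<open>f y - f x = - 1\<close> by \<open>y - x\<close> gives
  \<open>(y - x) (N + O(1)) = 1\<close>.
\<close>

text \<open>The right endpoint \<open>t\<close> is left free: \<open>t = 1\<close> yields the roots
  themselves, and \<open>t = r e\<close> yields their monotonicity.\<close>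

lemma cubic_root_exists:
  fixes b c d t :: real
  assumes "0 < d" "0 < t" "t ^ 3 + b * t ^ 2 + c * t + d < 0"
  shows "\<exists>x. 0 < x \<and> x < t \<and> x ^ 3 + b * x ^ 2 + c * x + d = 0"
proof -
  have "\<exists>x\<ge>0. x \<le> t \<and> x ^ 3 + b * x ^ 2 + c * x + d = 0"
    by (rule IVT2') (use assms in \<open>auto intro!: continuous_intros\<close>)
  then obtain x where x: "0 \<le> x" "x \<le> t" "x ^ 3 + b * x ^ 2 + c * x + d = 0"
    by blast
  then have "x \<noteq> 0" "x \<noteq> t"
    using assms by auto
  with x show ?thesis
    by (metis order_less_le)
qed

lemma cubic_root_unique:
  fixes b c d x y :: real
  assumes d: "0 < d" "1 + b + c + d < 0"
    and x: "0 < x" "x < 1" "x ^ 3 + b * x ^ 2 + c * x + d = 0"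
    and y: "0 < y" "y < 1" "y ^ 3 + b * y ^ 2 + c * y + d = 0"
  shows "x = y"
proof (rule ccontr)
  assume "x \<noteq> y"
  \<comment> \<open>The third root by Vieta, as the three roots sum to \<open>- b\<close>. Factoring
    \<open>x - y\<close> out of the difference of the two equations then gives Vieta's formula for
    \<open>c\<close>.\<close>
  define z where "z = - b - x - y"
  have "(x - y) * (x\<^sup>2 + x * y + y\<^sup>2 + b * (x + y) + c) = 0"
    using x(3) y(3) by (simp add: algebra_simps power2_eq_square power3_eq_cube)
  with \<open>x \<noteq> y\<close> have "x\<^sup>2 + x * y + y\<^sup>2 + b * (x + y) + c = 0"
    by simp
  then have c: "c = - (x\<^sup>2 + x * y + y\<^sup>2 + b * (x + y))"
    by linarith
  have d_eq: "d = - (x * y * z)"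
    using x(3) unfolding c z_def by (simp add: algebra_simps power2_eq_square power3_eq_cube)
  with d(1) have "x * y * z < 0"
    by simp
  then have "z < 0"
    using x(1) y(1) by (simp add: mult_less_0_iff zero_less_mult_iff)
  then have "0 < (1 - x) * (1 - y) * (1 - z)"
    using x(2) y(2) by simp
  also have "\<dots> = 1 + b + c + d"
    unfolding d_eq c z_def by (simp add: algebra_simps power2_eq_square)
  finally show False
    using d(2) by simp
qed

lemma gap_image:
  fixes r :: "nat \<Rightarrow> real"
  assumes "strict_mono_on {1..N} r" "i \<in> {1..N - 1}"
  shows "gap (r ` {1..N}) i = r (Suc i) - r i"
proof -
  have "sorted_wrt (<) (map r [1..<Suc N])"
    using assms(1)
    by (auto simp: sorted_wrt_iff_nth_less strict_mono_on_def simp del: upt_Suc)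
  then have "sorted_list_of_set (set (map r [1..<Suc N])) = map r [1..<Suc N]"
    by (intro sorted_list_of_set.idem_if_sorted_distinct)
       (auto simp: strict_sorted_iff simp del: upt_Suc)
  then have "sorted_list_of_set (r ` {1..N}) = map r [1..<Suc N]"
    by (simp add: atLeastLessThanSuc_atLeastAtMost del: upt_Suc)
  then show ?thesis
    \<comment> \<open>The list counts from 0 and \<open>r\<close> from 1, so entry \<open>i\<close>
      is \<open>r (Suc i)\<close>; splitting on \<open>i\<close> resolves
      \<open>i - 1\<close>.\<close>
    using assms(2) by (cases i) (auto simp: gap_def simp del: upt_Suc)
qed

lemma I3tr_enumeration:
  fixes b :: int and N :: nat
  defines "c \<equiv> - b - 2 - int N"
  obtains r :: "nat \<Rightarrow> real" where
    "I3tr b c = r ` {1..N}"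
    "strict_mono_on {1..N} r"
    "\<And>d. d \<in> {1..N} \<Longrightarrow> 0 < r d \<and> r d < 1"
    "\<And>d. d \<in> {1..N} \<Longrightarrow> r d ^ 3 + of_int b * r d ^ 2 + of_int c * r d + real d = 0"
proof -
  \<comment> \<open>The value of the cubic at 1 is \<open>d - N - 1\<close>.\<close>
  have neg: "1 + of_int b + of_int c + real d < 0" if "d \<in> {1..N}" for d
    using that by (simp add: c_def)
  have "\<forall>d\<in>{1..N}. \<exists>x. 0 < x \<and> x < 1 \<and>
      x ^ 3 + of_int b * x ^ 2 + of_int c * x + real d = 0"
    using cubic_root_exists[of _ 1 "of_int b" "of_int c"] neg by simp
  then obtain r where "\<forall>d\<in>{1..N}. 0 < r d \<and> r d < 1 \<and>
      r d ^ 3 + of_int b * r d ^ 2 + of_int c * r d + real d = 0"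
    unfolding bchoice_iff by blast
  then have r: "0 < r d" "r d < 1"
      "r d ^ 3 + of_int b * r d ^ 2 + of_int c * r d + real d = 0"
    if "d \<in> {1..N}" for d
    using that by blast+
  have uniq: "x = r d"
    if "d \<in> {1..N}" "0 < x" "x < 1" "x ^ 3 + of_int b * x ^ 2 + of_int c * x + real d = 0"
    for d x
    using that(1) by (intro cubic_root_unique[OF _ neg[OF that(1)] that(2-4) r[OF that(1)]]) simp
  show thesis
  proof
    show "I3tr b c = r ` {1..N}"
    proof (intro equalityI subsetI)
      fix x assume "x \<in> I3tr b c"
      then obtain d where x: "0 < x" "x < 1"
          "x ^ 3 + of_int b * x ^ 2 + of_int c * x + of_int d = 0"
        and d: "1 \<le> d" "d \<le> int N"
        by (auto simp: I3tr_def c_def)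
      then have "x = r (nat d)"
        by (intro uniq) auto
      moreover have "nat d \<in> {1..N}"
        using d by auto
      ultimately show "x \<in> r ` {1..N}"
        by blast
    next
      fix x assume "x \<in> r ` {1..N}"
      then obtain d where d: "d \<in> {1..N}" "x = r d"
        by blast
      then have "1 \<le> int d" "int d \<le> - b - c - 2"
        "x ^ 3 + of_int b * x ^ 2 + of_int c * x + of_int (int d) = 0"
        using r[of d] by (auto simp: c_def)
      moreover have "x \<in> {0<..<1}"
        using r(1,2)[of d] d by simp
      ultimately show "x \<in> I3tr b c"
        unfolding I3tr_def by blast
    qed
    show "strict_mono_on {1..N} r"
    proof (rule strict_mono_onI)
      fix d e assume de: "d \<in> {1..N}" "e \<in> {1..N}" "d < e"
      have "r e ^ 3 + of_int b * r e ^ 2 + of_int c * r e + real d < 0"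
        using r(3)[of e] de by simp
      then obtain x where x: "0 < x" "x < r e"
          "x ^ 3 + of_int b * x ^ 2 + of_int c * x + real d = 0"
        using cubic_root_exists[of "real d" "r e"] r(1)[of e] de by auto
      \<comment> \<open>By uniqueness the root \<open>x\<close> found to the left of
        \<open>r e\<close> is \<open>r d\<close>.\<close>
      then show "r d < r e"
        using uniq[of d x] r(2)[of e] de by simp
    qed
  qed (use r in auto)
qed

text \<open>From \<open>D * (N + E) = 1\<close> follows \<open>D - 1 / N = - D * E / N\<close>,
  which is of order \<open>K / N ^ 2\<close> once \<open>D * N\<close> is bounded. The constant
  \<open>4 * K ^ 2\<close> also covers the finitely many small \<open>N\<close>.\<close>

lemma spacing_estimate:
  fixes D E K :: real and N :: nat
  assumes N: "1 \<le> N" and D: "0 < D" "D < 1"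
    and eq: "D * (real N + E) = 1" and E: "\<bar>E\<bar> \<le> K" and K: "1 \<le> K"
  shows "\<bar>D - 1 / real N\<bar> \<le> 4 * K ^ 2 / real N ^ 2"
proof (cases "2 * K \<le> real N")
  case True
  \<comment> \<open>Here \<open>\<bar>E\<bar> \<le> K \<le> N / 2\<close>.\<close>
  have "D * (real N / 2) \<le> D * (real N + E)"
    using D E True by (intro mult_left_mono) auto
  then have DN: "D * real N \<le> 2"
    using eq by simp
  have "\<bar>D - 1 / real N\<bar> * real N ^ 2 = \<bar>(D - 1 / real N) * real N\<bar> * real N"
    by (simp add: abs_mult power2_eq_square)
  also have "(D - 1 / real N) * real N = - (D * E)"
    using N eq by (simp add: algebra_simps)
  also have "\<bar>- (D * E)\<bar> * real N = (D * real N) * \<bar>E\<bar>"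
    using D by (simp add: abs_mult)
  also have "\<dots> \<le> 2 * K"
    using DN E D by (intro mult_mono) auto
  also have "\<dots> \<le> 4 * K ^ 2"
    using K by (simp add: power2_eq_square)
  finally show ?thesis
    using N by (simp add: pos_le_divide_eq)
next
  case False
  \<comment> \<open>For \<open>N < 2 * K\<close> the trivial bound 1 suffices, since
    \<open>(2 * K) ^ 2 / N ^ 2\<close> exceeds it.\<close>
  have "0 < 1 / real N" "1 / real N \<le> 1"
    using N by auto
  then have "\<bar>D - 1 / real N\<bar> \<le> 1"
    using D by linarith
  also have "1 \<le> (2 * K) ^ 2 / real N ^ 2"
    using False N power_mono[of "real N" "2 * K" 2] by simp
  finally show ?thesis
    by (simp add: power_mult_distrib)
qed

theorem theorem13:
  fixes b :: int
  shows "almost_uniform_for_large (\<lambda>N. I3tr b (- b - 2 - int N))"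
proof -
  \<comment> \<open>Bounds the error \<open>E\<close> below: \<open>\<bar>b\<bar> + 2\<close> from
    its constant part, 3 from the quadratic terms, \<open>2 * \<bar>b\<bar>\<close> from
    \<open>b * (x + y)\<close>. It depends on \<open>b\<close> only.\<close>
  define K :: real where "K = 5 + 3 * \<bar>of_int b\<bar>"
  have "finite (I3tr b (- b - 2 - int N)) \<and> I3tr b (- b - 2 - int N) \<subseteq> {0..1} \<and>
      card (I3tr b (- b - 2 - int N)) = N" for N
  proof -
    obtain r where r: "I3tr b (- b - 2 - int N) = r ` {1..N}" "strict_mono_on {1..N} r"
      by (rule I3tr_enumeration)
    have "card (r ` {1..N}) = N"
      using strict_mono_on_imp_inj_on[OF r(2)] by (simp add: card_image)
    moreover have "I3tr b (- b - 2 - int N) \<subseteq> {0..1}"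
      by (auto simp: I3tr_def)
    ultimately show ?thesis
      using r(1) by simp
  qed
  moreover have "\<bar>gap (I3tr b (- b - 2 - int N)) i - 1 / real N\<bar> \<le> 4 * K ^ 2 / real N ^ 2"
    if N: "1 \<le> N" and i: "i \<in> {1..N - 1}" for N i
  proof -
    obtain r where r: "I3tr b (- b - 2 - int N) = r ` {1..N}" "strict_mono_on {1..N} r"
        "\<And>d. d \<in> {1..N} \<Longrightarrow> 0 < r d \<and> r d < 1"
        "\<And>d. d \<in> {1..N} \<Longrightarrow> r d ^ 3 + of_int b * r d ^ 2
           + of_int (- b - 2 - int N) * r d + real d = 0"
      using I3tr_enumeration by blast
    define x y where "x = r i" and "y = r (Suc i)"
    have mem: "i \<in> {1..N}" "Suc i \<in> {1..N}"
      using i by auto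
    have xy: "0 < x" "x < y" "y < 1"
      using r(3)[OF mem(1)] r(3)[OF mem(2)] strict_mono_onD[OF r(2) mem]
      by (auto simp: x_def y_def)
    \<comment> \<open>Chosen so that \<open>N + E\<close> is minus the difference quotient of the
      cubic between \<open>x\<close> and \<open>y\<close>, with \<open>b + 2 + N\<close> coming from
      the linear coefficient.\<close>
    define E where "E = of_int b + 2 - (x\<^sup>2 + x * y + y\<^sup>2 + of_int b * (x + y))"
    have "(y - x) * (real N + E) = 1"
      using r(4)[OF mem(1)] r(4)[OF mem(2)]
      by (simp add: E_def x_def y_def algebra_simps power2_eq_square power3_eq_cube)
    moreover have "\<bar>E\<bar> \<le> K"
    proof -
      have "0 \<le> x\<^sup>2" "x\<^sup>2 \<le> 1" "0 \<le> y\<^sup>2" "y\<^sup>2 \<le> 1" "0 \<le> x * y" "x * y \<le> 1"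
        using xy by (auto simp: power_le_one mult_le_one)
      moreover have "\<bar>of_int b * (x + y)\<bar> \<le> \<bar>of_int b\<bar> * 2"
        unfolding abs_mult using xy by (intro mult_left_mono) auto
      ultimately show ?thesis
        unfolding E_def K_def by linarith
    qed
    ultimately have "\<bar>(y - x) - 1 / real N\<bar> \<le> 4 * K ^ 2 / real N ^ 2"
      using N xy by (intro spacing_estimate) (auto simp: K_def)
    then show ?thesis
      unfolding r(1) gap_image[OF r(2) i] x_def y_def .
  qed
  ultimately show ?thesis
    unfolding almost_uniform_for_large_def unit_interval_family_def spacing_constant_def
    by blast
qed

end
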